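(* The generating function $S(x,0)$ whose coefficient of $x^n$ is the number of packing paths of width $n$ (i.e. paths of width $n$ ending on the $x$-axis) satisfies $$S(x,0)=\frac{x^2+r}{2x^2}=\frac{1-x^4-\sqrt{1-10x^4+9x^8}}{4x^4},\qquad\text{where } r=\frac{1-3x^4-\sqrt{9x^8-10x^4+1}}{2x^2}.$$ Moreover $[x^0]S(x,0)=1$, $$[x^{4n}]S(x,0)=\frac2n\sum_{k=0}^{n}4^k\binom nk\binom n{k+1}\qquad\text{for } n\ge1,$$ and all other coefficients are $0$. As $n\to\infty$, $$[x^{4n}]S(x,0)\sim\frac{3^{1+2n}}{\sqrt{\pi}\,(1+2n)^{3/2}}.$$
   Context: Consider the hexagonal packing of the plane by circles of radius $2$ with centers $(2+4i+2j,\,2\sqrt3\,j)$, $i,j\in\mathbb Z$; the origin is the tangency point of two horizontally adjacent circles. The tangency points cut every circle into six arcs. Traversed from left to right these give six types of steps (angles measured on the circle carrying the arc): $U$ from $180^\circ$ to $120^\circ$ (displacement $(1,\sqrt3)$), $F$ from $120^\circ$ to $60^\circ$ (displacement $(2,0)$), $D$ from $60^\circ$ to $0^\circ$ (displacement $(1,-\sqrt3)$), $\overline U$ from $300^\circ$ to $360^\circ$ (displacement $(1,\sqrt3)$), $\overline F$ from $240^\circ$ to $300^\circ$ (displacement $(2,0)$), $\overline D$ from $180^\circ$ to $240^\circ$ (displacement $(1,-\sqrt3)$). A path in the packing starts at the origin, is a concatenation of such arcs of circles of the packing, each starting where the previous one ends, and stays in the quarter plane $x,y\ge 0$. Equivalently,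 it is a word in $\{U,F,D,\overline U,\overline F,\overline D\}$ whose first step (if any) is $U$, in which $U$ or $\overline F$ can only be followed by $F$ or $\overline U$; $F$ or $\overline D$ only by $\overline F$ or $D$; $\overline U$ or $D$ only by $U$ or $\overline D$; and which never goes below ordinate $0$. A packing path is such a path ending on the $x$-axis. The empty path is allowed. The width of a path is the abscissa of its endpoint (so $U,D,\overline U,\overline D$ contribute $1$ and $F,\overline F$ contribute $2$). Square roots denote formal power series with constant term $1$; $a_n\sim b_n$ means $a_n/b_n\to1$. *)

theory Defs
  imports
    "HOL-Analysis.Analysis"
    "HOL-Computational_Algebra.Formal_Power_Series"
    "HOL-Library.Landau_Symbols"
begin

text \<open>The plane is the type of complex numbers. \<open>Ub\<close>, \<open>Fb\<close>, \<open>Db\<close> are the barred steps,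
  i.e. those on the lower half of a circle.\<close>

datatype step = U | F | D | Ub | Fb | Db

definition center :: "int \<times> int \<Rightarrow> complex" where
  "center c = (case c of (i, j) \<Rightarrow>
     Complex (2 + 4 * real_of_int i + 2 * real_of_int j) (2 * sqrt 3 * real_of_int j))"

definition circle_pt :: "int \<times> int \<Rightarrow> real \<Rightarrow> complex" where
  "circle_pt c \<theta> = center c + 2 * cis \<theta>"

fun start_angle :: "step \<Rightarrow> real" where
  "start_angle U = pi"
| "start_angle F = 2 * pi / 3"
| "start_angle D = pi / 3"
| "start_angle Ub = 5 * pi / 3"
| "start_angle Fb = 4 * pi / 3"
| "start_angle Db = pi"

fun end_angle :: "step \<Rightarrow> real" where
  "end_angle U = 2 * pi / 3"
| "end_angle F = pi / 3"
| "end_angle D = 0"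
| "end_angle Ub = 2 * pi"
| "end_angle Fb = 5 * pi / 3"
| "end_angle Db = 4 * pi / 3"

text \<open>An arc is given by the index of the circle carrying it and its type; distinct pairs are
  distinct arcs.\<close>

type_synonym arc = "(int \<times> int) \<times> step"

definition arc_start :: "arc \<Rightarrow> complex" where
  "arc_start a = circle_pt (fst a) (start_angle (snd a))"

definition arc_end :: "arc \<Rightarrow> complex" where
  "arc_end a = circle_pt (fst a) (end_angle (snd a))"

definition arc_points :: "arc \<Rightarrow> complex set" where
  "arc_points a = circle_pt (fst a) ` closed_segment (start_angle (snd a)) (end_angle (snd a))"

definition circle_path :: "arc list \<Rightarrow> bool" where
  "circle_path p \<longleftrightarrow>
     (p \<noteq> [] \<longrightarrow> arc_start (hd p) = 0) \<and>
     successively (\<lambda>a b. arc_end a = arc_start b) p \<and>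
     (\<forall>a\<in>set p. \<forall>z\<in>arc_points a. 0 \<le> Re z \<and> 0 \<le> Im z)"

definition path_end :: "arc list \<Rightarrow> complex" where
  "path_end p = (if p = [] then 0 else arc_end (last p))"

definition width :: "arc list \<Rightarrow> real" where
  "width p = Re (path_end p)"

definition packing_path :: "arc list \<Rightarrow> bool" where
  "packing_path p \<longleftrightarrow> circle_path p \<and> Im (path_end p) = 0"

text \<open>The series \<open>S(x,0)\<close>. The sets counted are finite, see \<open>finite_packing_paths\<close> below.\<close>

definition packing_gf :: "real fps" where
  "packing_gf = Abs_fps (\<lambda>n. real (card {p. packing_path p \<and> width p = real n}))"

text \<open>The square root with constant term 1 (for a series with constant term 1).
  It is used in quotients whose numerator is a multiple of the monomial in the denominator, so that
  division of power series is exact there.\<close>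

definition fps_sqrt :: "real fps \<Rightarrow> real fps" where
  "fps_sqrt f = fps_radical root 2 f"

lemma fps_sqrt:
  assumes "fps_nth f 0 = 1"
  shows "fps_sqrt f ^ 2 = f" and "fps_nth (fps_sqrt f) 0 = 1"
proof -
  show "fps_sqrt f ^ 2 = f"
    using power_radical[of f root 1] assms by (simp add: fps_sqrt_def numeral_2_eq_2)
  show "fps_nth (fps_sqrt f) 0 = 1"
    using assms by (simp add: fps_sqrt_def numeral_2_eq_2)
qed

fun step_disp :: "step \<Rightarrow> complex" where
  "step_disp U = Complex 1 (sqrt 3)"
| "step_disp F = Complex 2 0"
| "step_disp D = Complex 1 (- sqrt 3)"
| "step_disp Ub = Complex 1 (sqrt 3)"
| "step_disp Fb = Complex 2 0"
| "step_disp Db = Complex 1 (- sqrt 3)"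

lemma cis_values:
  "cis (pi / 3) = Complex (1/2) (sqrt 3 / 2)"
  "cis (2 * pi / 3) = Complex (-1/2) (sqrt 3 / 2)"
  "cis (4 * pi / 3) = Complex (-1/2) (- sqrt 3 / 2)"
  "cis (5 * pi / 3) = Complex (1/2) (- sqrt 3 / 2)"
proof -
  show c: "cis (pi / 3) = Complex (1/2) (sqrt 3 / 2)"
    by (simp add: complex_eq_iff cos_60 sin_60)
  have "cis (2 * pi / 3) = cis (pi / 3) * cis (pi / 3)"
    by (subst cis_mult) simp
  then show d: "cis (2 * pi / 3) = Complex (-1/2) (sqrt 3 / 2)"
    by (simp add: c complex_eq_iff)
  have "cis (4 * pi / 3) = cis (2 * pi / 3) * cis (2 * pi / 3)"
    by (subst cis_mult) simp
  then show "cis (4 * pi / 3) = Complex (-1/2) (- sqrt 3 / 2)"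
    by (simp add: d complex_eq_iff)
  then have "cis (4 * pi / 3) * cis (pi / 3) = Complex (1/2) (- sqrt 3 / 2)"
    by (simp add: c complex_eq_iff)
  then show "cis (5 * pi / 3) = Complex (1/2) (- sqrt 3 / 2)"
    by (simp add: cis_mult)
qed

lemma arc_end_eq: "arc_end a = arc_start a + step_disp (snd a)"
  by (cases "snd a")
     (simp_all add: arc_end_def arc_start_def circle_pt_def cis_values complex_eq_iff)

lemma center_inject: "center c = center c' \<longleftrightarrow> c = c'"
  by (cases c; cases c') (auto simp: center_def)

lemma arc_start_inject: "arc_start (c, s) = arc_start (c', s) \<longleftrightarrow> c = c'"
  by (simp add: arc_start_def circle_pt_def center_inject)

lemma chain_end:
  "successively (\<lambda>a b. arc_end a = arc_start b) p \<Longrightarrow> p \<noteq> [] \<Longrightarrow>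
     arc_end (last p) = arc_start (hd p) + (\<Sum>a\<leftarrow>p. step_disp (snd a))"
  by (induction p rule: induct_list012) (auto simp: arc_end_eq)

lemma length_le_Re: "real (length p) \<le> Re (\<Sum>a\<leftarrow>p. step_disp (snd a))"
proof (induction p)
  case (Cons a p)
  have "1 \<le> Re (step_disp (snd a))"
    by (cases "snd a") auto
  then show ?case using Cons by simp
qed simp

lemma length_le_width:
  assumes "circle_path p"
  shows "real (length p) \<le> width p"
  using length_le_Re[of p] chain_end[of p] assms
  by (auto simp: circle_path_def width_def path_end_def)

lemma chain_determined:
  assumes "successively (\<lambda>a b. arc_end a = arc_start b) p"
    and "successively (\<lambda>a b. arc_end a = arc_start b) q"
    and "p \<noteq> [] \<Longrightarrow> q \<noteq> [] \<Longrightarrow> arc_start (hd p) = arc_start (hd q)"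
    and "map snd p = map snd q"
  shows "p = q"
  using assms
proof (induction p arbitrary: q)
  case (Cons a p)
  then obtain b q' where q: "q = b # q'" by (cases q) auto
  have "a = b"
    using Cons.prems q by (cases a; cases b) (auto simp: arc_start_inject)
  moreover have "p = q'"
    using Cons.prems q \<open>a = b\<close> by (intro Cons.IH) (auto simp: successively_Cons)
  ultimately show ?case using q by simp
qed simp

lemma finite_packing_paths: "finite {p. packing_path p \<and> width p = real n}"
proof -
  let ?P = "{p. packing_path p \<and> width p = real n}"
  have "inj_on (map snd) ?P"
    by (intro inj_onI chain_determined) (auto simp: packing_path_def circle_path_def)
  moreover have "map snd ` ?P \<subseteq> {w. set w \<subseteq> {U, F, D, Ub, Fb, Db} \<and> length w \<le> n}"
  proof
    fix w assume "w \<in> map snd ` ?P"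
    then obtain p where "p \<in> ?P" "w = map snd p" by blast
    then have "length w \<le> n"
      using length_le_width[of p] by (auto simp: packing_path_def)
    moreover have "set w \<subseteq> {U, F, D, Ub, Fb, Db}"
      using step.exhaust by blast
    ultimately show "w \<in> {w. set w \<subseteq> {U, F, D, Ub, Fb, Db} \<and> length w \<le> n}" by simp
  qed
  moreover have "finite {w. set w \<subseteq> {U, F, D, Ub, Fb, Db} \<and> length w \<le> n}"
    by (rule finite_lists_length_le) simp
  ultimately show ?thesis
    using finite_imageD finite_subset by blast
qed

end

theory Submission
  imports Defs "HOL-Real_Asymp.Real_Asymp"
begin

text \<open>Classify tangency points by the two arcs leaving them to the right. The generating functions
  of the paths from a tangency point to the \<open>x\<close>-axis depend only on its class and height, and the
  first-step recurrences determine them uniquely; a geometric progression in the height solves them,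
  which yields \<open>(1 - x\<^sup>4) S = 1 - x\<^sup>4 + 2 x\<^sup>4 S\<^sup>2\<close> for \<open>S = S(x,0)\<close>. With \<open>y = x\<^sup>4\<close> and \<open>S = 1 + 2 w\<close> this
  is \<open>w = y (1 + w) (1 + 4 w)\<close>, to which Lagrange inversion applies. For the asymptotics, the
  coefficients of \<open>sqrt (1 - 9 y) sqrt (1 - y)\<close> are a convolution in which the factor
  \<open>sqrt (1 - y)\<close> contributes, by dominated convergence, its value at \<open>y = 1/9\<close>.\<close>

unbundle no vec_syntax
unbundle fps_syntax

section \<open>Lagrange inversion\<close>

lemma fps_nth_X_deriv: "(fps_X * fps_deriv f) $ n = of_nat n * f $ n"
  for f :: "'a::comm_ring_1 fps"
  by (cases n) simp_all

text \<open>For \<open>m > 0\<close>, \<open>w ^ m\<close> is \<open>fps_X\<close> times a series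
  composed with \<open>w\<close>, so its coefficient at \<open>Suc n\<close> is a linear combination
  of the coefficients at \<open>n\<close> of the powers of \<open>w\<close>. Induction on
  \<open>n\<close> turns these into coefficients of \<open>\<phi> ^ n\<close>, and the sum becomes a
  single coefficient of a product.\<close>

theorem fps_lagrange_inversion:
  fixes w \<phi> :: "'a::field_char_0 fps"
  assumes w: "w = fps_X * (\<phi> oo w)" and "m \<le> n"
  shows "of_nat n * (w ^ m) $ n = of_nat m * (\<phi> ^ n) $ (n - m)"
proof -
  have w0: "w $ 0 = 0" by (subst w) simp
  \<comment> \<open>The value 0 for \<open>m > n\<close> reflects that \<open>w\<close> has no
    constant term; with it the induction runs over all \<open>m\<close> without a side
    condition.\<close>
  have "of_nat n * (w ^ m) $ n = (if m \<le> n then of_nat m * (\<phi> ^ n) $ (n - m) else 0)"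
    for m n :: nat
  proof (induction n arbitrary: m)
    case 0
    then show ?case by simp
  next
    case (Suc n)
    show ?case
    proof (cases m)
      case 0
      then show ?thesis by simp
    next
      case (Suc l)
      have "w ^ m = fps_X * ((fps_X ^ l * \<phi>) oo w)"
        by (subst (1) Suc, subst (1) power_Suc2, subst (2) w)
           (simp add: fps_compose_mult_distrib[OF w0] fps_compose_power[OF w0, symmetric] fps_X_fps_compose_startby0[OF w0] mult_ac)
      then have eq: "(w ^ m) $ Suc n = (\<Sum>i=0..n. (fps_X ^ l * \<phi>) $ i * (w ^ i) $ n)"
        by (simp add: fps_compose_nth)
      \<comment> \<open>The induction hypothesis carries a factor \<open>n\<close> that is cancelled
        at the end, so \<open>n = 0\<close> is settled directly.\<close>
      show ?thesis
      proof (cases "n = 0")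
        case True
        then show ?thesis using eq Suc by (auto simp: fps_X_power_mult_nth)
      next
        case False
        have "of_nat n * (w ^ m) $ Suc n =
            (\<Sum>i=0..n. (fps_X ^ l * \<phi>) $ i * (of_nat n * (w ^ i) $ n))"
          unfolding eq sum_distrib_left by (simp add: mult_ac)
        also have "\<dots> = (\<Sum>i=0..n. (fps_X * fps_deriv (fps_X ^ l * \<phi>)) $ i * (\<phi> ^ n) $ (n - i))"
          unfolding Suc.IH
        proof (rule sum.cong[OF refl])
          fix i assume "i \<in> {0..n}"
          then show "(fps_X ^ l * \<phi>) $ i * (if i \<le> n then of_nat i * (\<phi> ^ n) $ (n - i) else 0) =
             (fps_X * fps_deriv (fps_X ^ l * \<phi>)) $ i * (\<phi> ^ n) $ (n - i)"
            by (cases i) (simp_all add: mult_ac del: fps_deriv_mult)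
        qed
        also have "\<dots> = (fps_X * fps_deriv (fps_X ^ l * \<phi>) * \<phi> ^ n) $ n"
          by (simp add: fps_mult_nth)
        \<comment> \<open>The factor \<open>Suc n\<close> turns
          \<open>fps_deriv \<phi> * \<phi> ^ n\<close> into the derivative of
          \<open>\<phi> ^ Suc n\<close>.\<close>
        also have "of_nat (Suc n) * \<dots> = (of_nat (Suc n) * (fps_X * fps_deriv (fps_X ^ l * \<phi>) * \<phi> ^ n)) $ n"
          by (simp only: fps_of_nat[symmetric] fps_mult_left_const_nth)
        also have "of_nat (Suc n) * (fps_X * fps_deriv (fps_X ^ l * \<phi>) * \<phi> ^ n) =
            fps_X ^ l * (of_nat (l * Suc n) * \<phi> ^ Suc n + fps_X * fps_deriv (\<phi> ^ Suc n))"
        proof -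
          have 1: "fps_X * fps_deriv (fps_X ^ l * \<phi>) = fps_X ^ l * (of_nat l * \<phi> + fps_X * fps_deriv \<phi>)"
            by (cases l) (simp_all add: fps_deriv_power algebra_simps flip: power_Suc fps_of_nat)
          have 2: "fps_deriv (\<phi> ^ Suc n) = of_nat (Suc n) * fps_deriv \<phi> * \<phi> ^ n"
            by (simp only: fps_deriv_power' diff_Suc_1)
          show ?thesis unfolding 1 2 by (simp add: algebra_simps)
        qed
        also have "\<dots> $ n = (if n < l then 0 else of_nat (l * Suc n) * (\<phi> ^ Suc n) $ (n - l)
             + of_nat (n - l) * (\<phi> ^ Suc n) $ (n - l))"
          unfolding fps_X_power_mult_nth fps_add_nth fps_nth_X_deriv
          by (simp only: fps_of_nat[symmetric] fps_mult_left_const_nth)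
        \<comment> \<open>For \<open>l \<le> n\<close>, \<open>l * Suc n + (n - l) = n * m\<close>
          because \<open>m = Suc l\<close>.\<close>
        also have "\<dots> = (if n < l then 0 else of_nat n * (of_nat m * (\<phi> ^ Suc n) $ (n - l)))"
          by (simp add: Suc algebra_simps of_nat_diff)
        finally have "of_nat n * (of_nat (Suc n) * (w ^ m) $ Suc n) =
            of_nat n * (if m \<le> Suc n then of_nat m * (\<phi> ^ Suc n) $ (Suc n - m) else 0)"
          by (auto simp: Suc mult_ac)
        then show ?thesis using False by simp
      qed
    qed
  qed
  then show ?thesis using \<open>m \<le> n\<close> by simp
qed

lemma fps_nth_linear_power: "((1 + fps_const c * fps_X) ^ n) $ k = of_nat (n choose k) * c ^ k"
  for c :: "'a::comm_ring_1"
proof (induction n arbitrary: k)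
  case (Suc n)
  then show ?case
    by (cases k) (simp_all add: algebra_simps)
next
  case 0
  then show ?case by (cases k) auto
qed

section \<open>Paths from tangency points\<close>

text \<open>In these coordinates all tangency points are integral, so equality of points becomes
  integer arithmetic.\<close>

definition lattice_pt :: "int \<Rightarrow> int \<Rightarrow> complex" where
  "lattice_pt x y = Complex (real_of_int x) (sqrt 3 * real_of_int y)"

lemma lattice_pt_eq_iff [simp]: "lattice_pt x y = lattice_pt x' y' \<longleftrightarrow> x = x' \<and> y = y'"
  by (simp add: lattice_pt_def)

lemma Re_lattice_pt [simp]: "Re (lattice_pt x y) = real_of_int x"
  and Im_lattice_pt [simp]: "Im (lattice_pt x y) = sqrt 3 * real_of_int y"
  by (simp_all add: lattice_pt_def)

lemma arc_start_simps:
  "arc_start ((i, j), U) = lattice_pt (4 * i + 2 * j) (2 * j)"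
  "arc_start ((i, j), F) = lattice_pt (4 * i + 2 * j + 1) (2 * j + 1)"
  "arc_start ((i, j), D) = lattice_pt (4 * i + 2 * j + 3) (2 * j + 1)"
  "arc_start ((i, j), Ub) = lattice_pt (4 * i + 2 * j + 3) (2 * j - 1)"
  "arc_start ((i, j), Fb) = lattice_pt (4 * i + 2 * j + 1) (2 * j - 1)"
  "arc_start ((i, j), Db) = lattice_pt (4 * i + 2 * j) (2 * j)"
  unfolding arc_start_def circle_pt_def fst_conv snd_conv start_angle.simps cis_values
  by (simp_all add: center_def lattice_pt_def complex_eq_iff algebra_simps)

lemma step_disp_lattice:
  "lattice_pt x y + step_disp U = lattice_pt (x + 1) (y + 1)"
  "lattice_pt x y + step_disp F = lattice_pt (x + 2) y"
  "lattice_pt x y + step_disp D = lattice_pt (x + 1) (y - 1)"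
  "lattice_pt x y + step_disp Ub = lattice_pt (x + 1) (y + 1)"
  "lattice_pt x y + step_disp Fb = lattice_pt (x + 2) y"
  "lattice_pt x y + step_disp Db = lattice_pt (x + 1) (y - 1)"
  by (simp_all add: lattice_pt_def complex_eq_iff algebra_simps)

text \<open>Both arcs start at 180 degrees on one circle. Classes are separated by the parity of the
  lattice ordinate and, for odd ordinates, by abscissa minus ordinate modulo 4: it is 0 where
  \<open>F\<close> and \<open>Ub\<close> start, 2 where \<open>D\<close> and \<open>Fb\<close>
  start.\<close>

lemma arcs_from_even:
  "arc_start a = lattice_pt (4 * i + 2 * j) (2 * j) \<longleftrightarrow> a = ((i, j), U) \<or> a = ((i, j), Db)"
proof (cases a)
  case (Pair c s)
  then show ?thesis by (cases c; cases s; simp add: arc_start_simps; presburger)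
qed

text \<open>The point at 120 degrees on circle \<open>(i, j)\<close> is the point at 300 degrees on
  circle \<open>(i - 1, j + 1)\<close>.\<close>

lemma arcs_from_odd_left:
  "arc_start a = lattice_pt (4 * i + 2 * j + 1) (2 * j + 1) \<longleftrightarrow>
     a = ((i, j), F) \<or> a = ((i - 1, j + 1), Ub)"
proof (cases a)
  case (Pair c s)
  then show ?thesis by (cases c; cases s; simp add: arc_start_simps; presburger)
qed

text \<open>The point at 60 degrees on circle \<open>(i, j)\<close> is the point at 240 degrees on
  circle \<open>(i, j + 1)\<close>.\<close>

lemma arcs_from_odd_right:
  "arc_start a = lattice_pt (4 * i + 2 * j + 3) (2 * j + 1) \<longleftrightarrow>
     a = ((i, j), D) \<or> a = ((i, j + 1), Fb)"
proof (cases a)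
  case (Pair c s)
  then show ?thesis by (cases c; cases s; simp add: arc_start_simps; presburger)
qed

section \<open>Arcs inside the quarter plane\<close>

definition in_quarter :: "arc \<Rightarrow> bool" where
  "in_quarter a \<longleftrightarrow> (\<forall>z\<in>arc_points a. 0 \<le> Re z \<and> 0 \<le> Im z)"

lemma in_quarter_end: "in_quarter a \<Longrightarrow> 0 \<le> Im (arc_end a)"
  by (auto simp: in_quarter_def arc_points_def arc_end_def)

text \<open>Every arc is leftmost at its start, so a start with nonnegative abscissa keeps the whole
  arc in the right half plane. Lower arcs are reflected by \<open>2 * pi - \<theta>\<close> into the
  range where \<open>cos\<close> decreases.\<close>

lemma cos_ge_cos_start:
  assumes "\<theta> \<in> closed_segment (start_angle s) (end_angle s)"
  shows "cos (start_angle s) \<le> cos \<theta>"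
proof (cases s)
  case U
  then show ?thesis by simp
next
  case F
  then show ?thesis using assms
    by (auto simp: closed_segment_eq_real_ivl split: if_splits intro!: cos_monotone_0_pi_le)
next
  case D
  then show ?thesis using assms
    by (auto simp: closed_segment_eq_real_ivl split: if_splits intro!: cos_monotone_0_pi_le)
next
  case Ub
  then have "cos (2 * pi - start_angle s) \<le> cos (2 * pi - \<theta>)" using assms
    by (intro cos_monotone_0_pi_le) (auto simp: closed_segment_eq_real_ivl split: if_splits)
  then show ?thesis by (simp add: cos_2pi_minus)
next
  case Fb
  then have "cos (2 * pi - start_angle s) \<le> cos (2 * pi - \<theta>)" using assms
    by (intro cos_monotone_0_pi_le) (auto simp: closed_segment_eq_real_ivl split: if_splits)
  then show ?thesis by (simp add: cos_2pi_minus)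
next
  case Db
  then show ?thesis by simp
qed

lemma sin_nonneg_upper:
  assumes "\<theta> \<in> closed_segment (start_angle s) (end_angle s)" "s \<in> {U, F, D}"
  shows "0 \<le> sin \<theta>"
proof (rule sin_ge_zero)
  have "0 \<le> end_angle s" "end_angle s \<le> start_angle s" "start_angle s \<le> pi"
    using assms(2) pi_gt_zero by auto
  then show "0 \<le> \<theta>" "\<theta> \<le> pi"
    using assms(1) by (auto simp: closed_segment_eq_real_ivl split: if_splits)
qed

lemma in_quarterI:
  assumes "0 \<le> Re (arc_start ((i, j), s))" and "0 < j \<or> j = 0 \<and> s \<in> {U, F, D}"
  shows "in_quarter ((i, j), s)"
  unfolding in_quarter_def arc_points_def
proof (intro ballI)
  fix z assume "z \<in> circle_pt (fst ((i, j), s)) `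
    closed_segment (start_angle (snd ((i, j), s))) (end_angle (snd ((i, j), s)))"
  then obtain \<theta> where \<theta>: "\<theta> \<in> closed_segment (start_angle s) (end_angle s)"
    and z: "z = circle_pt (i, j) \<theta>" by auto
  have "0 \<le> Re z"
    using assms(1) cos_ge_cos_start[OF \<theta>] by (simp add: z arc_start_def circle_pt_def)
  moreover have "0 \<le> Im z"
    using assms(2)
  proof
    assume "0 < j"
    \<comment> \<open>The centre then has ordinate at least the radius 2, so the whole circle lies
      above the axis.\<close>
    then have "1 * 1 \<le> sqrt 3 * real_of_int j" by (intro mult_mono) auto
    moreover have "-1 \<le> sin \<theta>" by simp
    ultimately have "0 \<le> 2 * (sqrt 3 * real_of_int j) + 2 * sin \<theta>" by linarith
    then show ?thesis by (simp add: z circle_pt_def center_def mult.assoc)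
  next
    assume "j = 0 \<and> s \<in> {U, F, D}"
    then show ?thesis using sin_nonneg_upper[OF \<theta>] by (simp add: z circle_pt_def center_def)
  qed
  ultimately show "0 \<le> Re z \<and> 0 \<le> Im z" by simp
qed

section \<open>Counting paths by their first arc\<close>

text \<open>The parameter \<open>t\<close> is the horizontal distance still to be covered. It is
  real, so that removing a first arc is a plain subtraction; negative values simply admit no
  path.\<close>

definition paths_from :: "complex \<Rightarrow> real \<Rightarrow> arc list set" where
  "paths_from z t = {p. (p \<noteq> [] \<longrightarrow> arc_start (hd p) = z) \<and>
     successively (\<lambda>a b. arc_end a = arc_start b) p \<and> (\<forall>a\<in>set p. in_quarter a) \<and>
     (if p = [] then z else arc_end (last p)) = Complex (Re z + t) 0}"

lemma Nil_in_paths_from: "[] \<in> paths_from z t \<longleftrightarrow> Im z = 0 \<and> t = 0"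
  by (auto simp: paths_from_def complex_eq_iff)

lemma Cons_in_paths_from:
  "a # p \<in> paths_from z t \<longleftrightarrow>
     arc_start a = z \<and> in_quarter a \<and> p \<in> paths_from (arc_end a) (t - Re (step_disp (snd a)))"
  by (auto simp: paths_from_def successively_Cons complex_eq_iff arc_end_eq)

lemma packing_path_iff: "packing_path p \<and> width p = t \<longleftrightarrow> p \<in> paths_from 0 t"
  by (auto simp: packing_path_def circle_path_def width_def path_end_def paths_from_def
      in_quarter_def complex_eq_iff)

lemma paths_from_negative: "t < 0 \<Longrightarrow> paths_from z t = {}"
proof -
  have "p \<in> paths_from z t \<Longrightarrow> 0 \<le> t" for p
  proof (induction p arbitrary: z t)
    case (Cons a p)
    then have "0 \<le> t - Re (step_disp (snd a))"
      unfolding Cons_in_paths_from by blast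
    moreover have "0 \<le> Re (step_disp (snd a))" by (cases "snd a") auto
    ultimately show ?case by simp
  qed (simp add: Nil_in_paths_from)
  then show "t < 0 \<Longrightarrow> paths_from z t = {}" by fastforce
qed

text \<open>Finiteness travels with the count because \<open>card\<close> is 0 on infinite
  sets.\<close>

definition has_card :: "'a set \<Rightarrow> real \<Rightarrow> bool" where
  "has_card A c \<longleftrightarrow> finite A \<and> real (card A) = c"

text \<open>Nonempty paths split disjointly by their first arc, which must belong to
  \<open>As\<close>; the \<open>of_bool\<close> term accounts for the empty path.\<close>

lemma has_card_paths_from:
  assumes As: "\<And>a. arc_start a = z \<and> in_quarter a \<longleftrightarrow> a \<in> As" and fin: "finite As"
    and c: "\<And>a. a \<in> As \<Longrightarrow>
      has_card (paths_from (arc_end a) (t - Re (step_disp (snd a)))) (c a)"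
  shows "has_card (paths_from z t) (of_bool (Im z = 0 \<and> t = 0) + (\<Sum>a\<in>As. c a))"
proof -
  let ?Q = "\<lambda>a. paths_from (arc_end a) (t - Re (step_disp (snd a)))"
  let ?E = "{p :: arc list. p = [] \<and> Im z = 0 \<and> t = 0}"
  have eq: "paths_from z t = ?E \<union> (\<Union>a\<in>As. Cons a ` ?Q a)" (is "_ = _ \<union> ?C")
  proof (rule set_eqI)
    show "p \<in> paths_from z t \<longleftrightarrow> p \<in> ?E \<union> ?C" for p
    proof (cases p)
      case (Cons a q)
      then show ?thesis
        unfolding Cons Cons_in_paths_from conj_assoc[symmetric] As by blast
    qed (auto simp: Nil_in_paths_from)
  qed
  have Q: "finite (?Q a)" "real (card (?Q a)) = c a" if "a \<in> As" for a
    using c that by (auto simp: has_card_def)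
  have "card ?C = (\<Sum>a\<in>As. card (Cons a ` ?Q a))"
    using fin Q by (intro card_UN_disjoint) auto
  also have "real \<dots> = (\<Sum>a\<in>As. c a)"
    unfolding of_nat_sum by (intro sum.cong) (auto simp: card_image Q)
  finally have C: "real (card ?C) = (\<Sum>a\<in>As. c a)" .
  have E: "finite ?E" "card ?E = of_bool (Im z = 0 \<and> t = 0)" by auto
  have "finite ?C" using fin Q by auto
  moreover have "card (?E \<union> ?C) = card ?E + card ?C"
    by (rule card_Un_disjoint[OF E(1) \<open>finite ?C\<close>]) auto
  ultimately show ?thesis
    unfolding has_card_def eq using C E by simp
qed

text \<open>An arc of width \<open>d\<close> becomes a factor \<open>fps_X ^ d\<close>. As
  \<open>d > 0\<close>, only smaller widths are needed, and for \<open>d > n\<close> both sides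
  vanish.\<close>

lemma has_card_shift:
  assumes "\<And>m. m < n \<Longrightarrow> has_card (paths_from z (real m)) (G $ m)" and "d > 0"
  shows "has_card (paths_from z (real n - real d)) ((fps_X ^ d * G) $ n)"
proof (cases "d \<le> n")
  case True
  then have "real n - real d = real (n - d)" by simp
  then show ?thesis
    using assms(1)[of "n - d"] assms(2) True by (simp add: fps_X_power_mult_nth)
next
  case False
  then show ?thesis
    by (simp add: paths_from_negative has_card_def fps_X_power_mult_nth)
qed

text \<open>The shifted indices stay explicit, so that each end point has the shape of one of the
  three classes of start points.\<close>

lemma arc_end_simps:
  "arc_end ((i, j), U) = lattice_pt (4 * i + 2 * j + 1) (2 * j + 1)"
  "arc_end ((i, j), F) = lattice_pt (4 * i + 2 * j + 3) (2 * j + 1)"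
  "arc_end ((i, j), D) = lattice_pt (4 * (i + 1) + 2 * j) (2 * j)"
  "arc_end ((i - 1, j + 1), Ub) = lattice_pt (4 * i + 2 * (j + 1)) (2 * (j + 1))"
  "arc_end ((i, j + 1), Fb) = lattice_pt (4 * (i + 1) + 2 * j + 1) (2 * j + 1)"
  "arc_end ((i, j), Db) = lattice_pt (4 * i + 2 * (j - 1) + 3) (2 * (j - 1) + 1)"
  unfolding arc_end_eq snd_conv arc_start_simps step_disp_lattice by simp_all

text \<open>The three classes of tangency points are told apart by the arcs leaving them:
  \<open>U\<close> and \<open>Db\<close> (series \<open>GA\<close>), \<open>F\<close> and \<open>Ub\<close> (series \<open>GB\<close>), \<open>D\<close> and \<open>Fb\<close> (series \<open>GC\<close>).\<close>

lemma has_card_paths_from_vertex: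
  fixes GA GB GC :: "nat \<Rightarrow> real fps"
  assumes A0: "GA 0 = 1 + fps_X * GB 0"
    and A: "\<And>k. GA (Suc k) = fps_X * GB (Suc k) + fps_X * GC k"
    and B: "\<And>k. GB k = fps_X ^ 2 * GC k + fps_X * GA (Suc k)"
    and C: "\<And>k. GC k = fps_X ^ 2 * GB k + fps_X * GA k"
  assumes "0 \<le> j"
  shows "0 \<le> 4 * i + 2 * j \<Longrightarrow>
      has_card (paths_from (lattice_pt (4 * i + 2 * j) (2 * j)) (real n)) (GA (nat j) $ n)"
    and "0 \<le> 4 * i + 2 * j + 1 \<Longrightarrow>
      has_card (paths_from (lattice_pt (4 * i + 2 * j + 1) (2 * j + 1)) (real n)) (GB (nat j) $ n)"
    and "0 \<le> 4 * i + 2 * j + 3 \<Longrightarrow>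
      has_card (paths_from (lattice_pt (4 * i + 2 * j + 3) (2 * j + 1)) (real n)) (GC (nat j) $ n)"
  using \<open>0 \<le> j\<close>
proof (induction n arbitrary: i j rule: less_induct)
  case (less n)
  \<comment> \<open>Every arc has positive width, so one induction on \<open>n\<close> serves all
    classes and heights at once, although some arcs lead upwards.\<close>
  note IH_A = has_card_shift[OF less(1)] and IH_B = has_card_shift[OF less(2)]
    and IH_C = has_card_shift[OF less(3)]
  {
    case 1
    let ?z = "lattice_pt (4 * i + 2 * j) (2 * j)"
    have U: "in_quarter ((i, j), U)"
      using 1 by (intro in_quarterI) (auto simp: arc_start_simps)
    have cU: "has_card (paths_from (arc_end ((i, j), U)) (real n - real 1)) ((fps_X ^ 1 * GB (nat j)) $ n)"
      unfolding arc_end_simps using 1 by (intro IH_B) auto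
    show ?case
    proof (cases "j = 0")
      case True
      \<comment> \<open>From the axis \<open>Db\<close> would end at ordinate
        \<open>- sqrt 3\<close>, so only \<open>U\<close> remains; the empty path supplies the 1 in
        \<open>A0\<close>.\<close>
      have "\<not> in_quarter ((i, j), Db)"
        using in_quarter_end[of "((i, j), Db)"] True by (auto simp: arc_end_simps)
      then have "has_card (paths_from ?z (real n))
          (of_bool (Im ?z = 0 \<and> real n = 0) + (\<Sum>a\<in>{((i, j), U)}. (fps_X ^ 1 * GB (nat j)) $ n))"
        using U cU by (intro has_card_paths_from) (auto simp: arcs_from_even)
      then show ?thesis by (cases n) (simp_all add: A0 True)
    next
      case False
      then have j: "0 < j" "nat j = Suc (nat (j - 1))" using 1 by auto
      have A': "GA (nat j) = fps_X * GB (nat j) + fps_X * GC (nat (j - 1))"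
        using A[of "nat (j - 1)"] by (simp only: j(2)[symmetric])
      have Db: "in_quarter ((i, j), Db)"
        using 1 j by (intro in_quarterI) (auto simp: arc_start_simps)
      have cDb: "has_card (paths_from (arc_end ((i, j), Db)) (real n - real 1))
          ((fps_X ^ 1 * GC (nat (j - 1))) $ n)"
        unfolding arc_end_simps using 1 j by (intro IH_C) auto
      have "has_card (paths_from ?z (real n))
          (of_bool (Im ?z = 0 \<and> real n = 0) + (\<Sum>a\<in>{((i, j), U), ((i, j), Db)}.
            if snd a = U then (fps_X ^ 1 * GB (nat j)) $ n else (fps_X ^ 1 * GC (nat (j - 1))) $ n))"
        using U Db cU cDb by (intro has_card_paths_from) (auto simp: arcs_from_even)
      then show ?thesis using False by (cases n) (simp_all add: A')
    qed
  next
    case 2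
    let ?z = "lattice_pt (4 * i + 2 * j + 1) (2 * j + 1)"
    \<comment> \<open>Points of odd lattice ordinate are off the axis, so the empty path does not
      count.\<close>
    have pos: "sqrt 3 * (2 * real_of_int j + 1) \<noteq> 0" using 2 by simp
    have Q: "in_quarter ((i, j), F)" "in_quarter ((i - 1, j + 1), Ub)"
      using 2 by (auto intro!: in_quarterI simp: arc_start_simps)
    have c1: "has_card (paths_from (arc_end ((i, j), F)) (real n - real 2)) ((fps_X ^ 2 * GC (nat j)) $ n)"
      unfolding arc_end_simps using 2 by (intro IH_C) auto
    have c2: "has_card (paths_from (arc_end ((i - 1, j + 1), Ub)) (real n - real 1))
        ((fps_X ^ 1 * GA (nat (j + 1))) $ n)"
      unfolding arc_end_simps using 2 by (intro IH_A) auto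
    have "nat (j + 1) = Suc (nat j)" using 2 by simp
    then have B': "GB (nat j) = fps_X ^ 2 * GC (nat j) + fps_X * GA (nat (j + 1))"
      using B[of "nat j"] by (simp only:)
    have "has_card (paths_from ?z (real n))
        (of_bool (Im ?z = 0 \<and> real n = 0) + (\<Sum>a\<in>{((i, j), F), ((i - 1, j + 1), Ub)}.
          if snd a = F then (fps_X ^ 2 * GC (nat j)) $ n else (fps_X ^ 1 * GA (nat (j + 1))) $ n))"
      using Q c1 c2 by (intro has_card_paths_from) (auto simp: arcs_from_odd_left)
    then show ?case using pos by (cases n) (simp_all add: B')
  next
    case 3
    let ?z = "lattice_pt (4 * i + 2 * j + 3) (2 * j + 1)"
    have pos: "sqrt 3 * (2 * real_of_int j + 1) \<noteq> 0" using 3 by simp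
    have Q: "in_quarter ((i, j), D)" "in_quarter ((i, j + 1), Fb)"
      using 3 by (auto intro!: in_quarterI simp: arc_start_simps)
    have c1: "has_card (paths_from (arc_end ((i, j), D)) (real n - real 1)) ((fps_X ^ 1 * GA (nat j)) $ n)"
      unfolding arc_end_simps using 3 by (intro IH_A) auto
    have c2: "has_card (paths_from (arc_end ((i, j + 1), Fb)) (real n - real 2))
        ((fps_X ^ 2 * GB (nat j)) $ n)"
      unfolding arc_end_simps using 3 by (intro IH_B) auto
    have "has_card (paths_from ?z (real n))
        (of_bool (Im ?z = 0 \<and> real n = 0) + (\<Sum>a\<in>{((i, j), D), ((i, j + 1), Fb)}.
          if snd a = D then (fps_X ^ 1 * GA (nat j)) $ n else (fps_X ^ 2 * GB (nat j)) $ n))"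
      using Q c1 c2 by (intro has_card_paths_from) (auto simp: arcs_from_odd_right)
    then show ?case using pos by (cases n) (simp_all add: C[of "nat j"] add.commute)
  }
qed

section \<open>Solving the recurrences\<close>

text \<open>Any solution of the recurrences in \<open>has_card_paths_from_vertex\<close> gives the
  counts, so it is enough to build one with \<open>GA 0 = S\<close>.\<close>

lemma packing_gf_unique:
  assumes S: "(1 - fps_X ^ 4) * S = 1 - fps_X ^ 4 + 2 * fps_X ^ 4 * S ^ 2"
  shows "packing_gf = S"
proof -
  \<comment> \<open>A descent from level \<open>Suc k\<close> is an excursion above that level
    followed by \<open>Db\<close>, which suggests \<open>GA (Suc k) = fps_X * S * GC k\<close>.
    Eliminating \<open>GB\<close> from the recurrences for \<open>GB\<close> and \<open>GC\<close>
    then leaves \<open>GC k = fps_X * I * GA k\<close>.\<close>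
  define I where "I = inverse (1 - fps_X ^ 4 * (1 + S))"
  have I: "(1 - fps_X ^ 4 * (1 + S)) * I = 1"
    unfolding I_def by (rule inverse_mult_eq_1') simp
  have I': "fps_X ^ 4 * (1 + S) * I = I - 1"
    using I by (simp add: algebra_simps)
  have "(1 - fps_X ^ 4 * (1 + S)) * (S * (2 - I)) =
      2 * (1 - fps_X ^ 4 * (1 + S)) * S - S * ((1 - fps_X ^ 4 * (1 + S)) * I)"
    by (simp add: algebra_simps)
  also have "\<dots> = 1 - fps_X ^ 4 * (1 + S)"
    unfolding I using S by (simp add: algebra_simps power2_eq_square)
  finally have "I * (1 - fps_X ^ 4 * (1 + S)) * (S * (2 - I)) = I * (1 - fps_X ^ 4 * (1 + S))"
    by (simp only: mult.assoc)
  \<comment> \<open>The quadratic equation enters in this form: both recurrences at even ordinates,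
    \<open>A0\<close> and \<open>A\<close>, reduce to it.\<close>
  then have SI: "S * (2 - I) = 1"
    using I by (simp only: mult.commute[of I] mult_1_left)
  \<comment> \<open>The ratio of \<open>GA (Suc k)\<close> to \<open>GA k\<close> that results from
    the two relations suggested above.\<close>
  define K where "K = fps_X ^ 2 * S * I"
  define GA where "GA = (\<lambda>k. K ^ k * S)"
  define GC where "GC = (\<lambda>k. fps_X * I * K ^ k * S)"
  define GB where "GB = (\<lambda>k. fps_X ^ 2 * (1 + S) * GC k)"
  have XGB: "fps_X * GB k = (fps_X ^ 4 * (1 + S) * I) * (K ^ k * S)" for k
    by (simp add: GB_def GC_def mult_ac eval_nat_numeral)
  have "1 + fps_X * GB 0 = 1 + (S * I - S)"
    unfolding XGB I' by (simp add: algebra_simps)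
  also have "\<dots> = S * (2 - I) + (S * I - S)"
    by (simp only: SI)
  also have "\<dots> = S"
    by (simp add: algebra_simps)
  finally have A0: "GA 0 = 1 + fps_X * GB 0"
    by (simp add: GA_def)
  have C: "GC k = fps_X ^ 2 * GB k + fps_X * GA k" for k
  proof -
    have "fps_X ^ 2 * GB k = fps_X * (fps_X ^ 4 * (1 + S) * I) * (K ^ k * S)"
      by (simp add: GB_def GC_def mult_ac eval_nat_numeral)
    then show ?thesis unfolding I' by (simp add: GA_def GC_def algebra_simps)
  qed
  have B: "GB k = fps_X ^ 2 * GC k + fps_X * GA (Suc k)" for k
    by (simp add: GA_def GB_def GC_def K_def algebra_simps)
  have A: "GA (Suc k) = fps_X * GB (Suc k) + fps_X * GC k" for k
  proof -
    have "GA (Suc k) - fps_X * GB (Suc k) = K * (2 - I) * (K ^ k * S)"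
      unfolding XGB I' by (simp add: GA_def algebra_simps)
    also have "\<dots> = (S * (2 - I)) * (fps_X ^ 2 * I * (K ^ k * S))"
      by (simp only: K_def mult_ac)
    also have "\<dots> = fps_X * GC k"
      unfolding SI by (simp add: GC_def mult_ac power2_eq_square)
    finally show ?thesis by (simp add: algebra_simps)
  qed
  have "has_card (paths_from 0 (real n)) (S $ n)" for n
  proof -
    have "has_card (paths_from (lattice_pt (4 * 0 + 2 * 0) (2 * 0)) (real n)) (GA (nat 0) $ n)"
      by (rule has_card_paths_from_vertex(1)[where GA = GA, OF A0 A B C]) simp_all
    moreover have "lattice_pt (4 * 0 + 2 * 0) (2 * 0) = 0"
      by (simp add: complex_eq_iff)
    moreover have "GA (nat 0) = S"
      by (simp add: GA_def)
    ultimately show ?thesis by (simp only:)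
  qed
  then show ?thesis
    unfolding packing_gf_def packing_path_iff has_card_def by (simp add: fps_eq_iff)
qed

section \<open>The algebraic series\<close>

lemma fps_nth_compose_X_power:
  fixes f :: "'a::comm_ring_1 fps"
  assumes "k > 0"
  shows "(f oo fps_X ^ k) $ n = (if k dvd n then f $ (n div k) else 0)"
proof -
  have "(f oo fps_X ^ k) $ n = (\<Sum>i=0..n. f $ i * (if n = k * i then 1 else 0))"
    unfolding fps_compose_nth power_mult[symmetric] by (simp add: fps_X_power_iff)
  also have "\<dots> = (\<Sum>i\<in>{i\<in>{0..n}. n = k * i}. f $ i)"
    by (subst sum.inter_filter) (auto intro!: sum.cong)
  also have "{i\<in>{0..n}. n = k * i} = (if k dvd n then {n div k} else {})"
    using assms by auto
  finally show ?thesis by simp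
qed

lemma fps_sqrt_unique:
  assumes "a ^ 2 = b" "b $ 0 = 1" "a $ 0 = 1"
  shows "fps_sqrt b = a"
  using radical_unique[of root 1 b a] assms by (simp add: fps_sqrt_def numeral_2_eq_2)

text \<open>With \<open>fps_X\<close> standing for the fourth power of the original variable, the
  radicand \<open>(1 - fps_X) * (1 - 9 * fps_X)\<close> is the discriminant of the quadratic
  equation for the counting series.\<close>

definition disc_root :: "real fps" where
  "disc_root = fps_sqrt (1 - 10 * fps_X + 9 * fps_X ^ 2)"

text \<open>The root \<open>(1 - fps_X - disc_root) / (4 * fps_X)\<close> with its numerator
  rationalised: the denominator now has constant term 2 and is invertible.\<close>

definition arch_gf :: "real fps" where
  "arch_gf = 2 * (1 - fps_X) * inverse (1 - fps_X + disc_root)"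

lemma disc_root: "disc_root ^ 2 = 1 - 10 * fps_X + 9 * fps_X ^ 2" "disc_root $ 0 = 1"
  unfolding disc_root_def by (intro fps_sqrt; simp)+

lemma arch_gf_linear: "4 * fps_X * arch_gf = 1 - fps_X - disc_root"
proof -
  let ?E = "1 - fps_X + disc_root"
  have E: "inverse ?E * ?E = 1"
    by (rule inverse_mult_eq_1) (simp add: disc_root)
  have "(1 - fps_X - disc_root) * ?E = (1 - fps_X) ^ 2 - disc_root ^ 2"
    by (simp add: algebra_simps power2_eq_square)
  also have "\<dots> = 8 * fps_X * (1 - fps_X)"
    unfolding disc_root by (simp add: algebra_simps power2_eq_square)
  finally have N: "(1 - fps_X - disc_root) * ?E = 8 * fps_X * (1 - fps_X)" .
  have "4 * fps_X * arch_gf = 8 * fps_X * (1 - fps_X) * inverse ?E"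
    by (simp add: arch_gf_def mult_ac)
  also have "\<dots> = (1 - fps_X - disc_root) * (inverse ?E * ?E)"
    unfolding N[symmetric] by (simp only: mult_ac)
  finally show ?thesis unfolding E by simp
qed

lemma arch_gf_quadratic:
  "(1 - fps_X) * arch_gf = 1 - fps_X + 2 * fps_X * arch_gf ^ 2"
proof -
  have R: "disc_root = 1 - fps_X - 4 * fps_X * arch_gf"
    unfolding arch_gf_linear by simp
  \<comment> \<open>Squaring \<open>R\<close> gives the claim multiplied by
    \<open>8 * fps_X\<close>, which cancels.\<close>
  have "8 * fps_X * ((1 - fps_X) * arch_gf) = 8 * fps_X * (1 - fps_X + 2 * fps_X * arch_gf ^ 2)"
    using disc_root(1)[unfolded R] by (simp add: algebra_simps power2_eq_square)
  then show ?thesis by simp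
qed

lemma arch_gf_nth_0: "arch_gf $ 0 = 1"
  using arg_cong[OF arch_gf_quadratic, of "\<lambda>f. f $ 0"] by simp

lemma arch_gf_nth:
  assumes "n \<ge> 1"
  shows "arch_gf $ n =
    2 / real n * (\<Sum>k=0..n. 4 ^ k * real (n choose k) * real (n choose (k + 1)))"
proof -
  define w where "w = fps_const (1 / 2) * (arch_gf - 1)"
  define \<phi> where "\<phi> = (1 + fps_const 4 * fps_X) * (1 + fps_const 1 * fps_X :: real fps)"
  have "2 * w = (2 * fps_const (1 / 2)) * (arch_gf - 1)"
    by (simp add: w_def)
  also have "2 * fps_const (1 / 2) = (1 :: real fps)"
    by (simp add: numeral_fps_const)
  finally have T: "arch_gf = 1 + 2 * w" by (simp add: algebra_simps)
  have w0: "w $ 0 = 0" by (simp add: w_def arch_gf_nth_0)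
  have "2 * w = 2 * (fps_X * ((1 + 4 * w) * (1 + w)))"
    using arch_gf_quadratic unfolding T by (simp add: algebra_simps power2_eq_square)
  moreover have "\<phi> oo w = (1 + 4 * w) * (1 + w)"
    by (simp add: \<phi>_def fps_compose_mult_distrib[OF w0] fps_compose_add_distrib w0 numeral_fps_const)
  ultimately have "w = fps_X * (\<phi> oo w)" by simp
  from fps_lagrange_inversion[OF this assms]
  have "real n * w $ n = (\<phi> ^ n) $ (n - 1)" by simp
  also have "\<dots> = (\<Sum>k=0..n-1. 4 ^ k * real (n choose k) * real (n choose (n - 1 - k)))"
    unfolding \<phi>_def power_mult_distrib fps_mult_nth fps_nth_linear_power by (simp add: mult_ac)
  also have "\<dots> = (\<Sum>k=0..n-1. 4 ^ k * real (n choose k) * real (n choose (k + 1)))"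
  proof (rule sum.cong[OF refl])
    fix k assume "k \<in> {0..n-1}"
    then have "n choose (n - 1 - k) = n choose (k + 1)"
      using assms by (subst binomial_symmetric) auto
    then show "4 ^ k * real (n choose k) * real (n choose (n - 1 - k)) =
      4 ^ k * real (n choose k) * real (n choose (k + 1))" by simp
  qed
  \<comment> \<open>The added term \<open>k = n\<close> vanishes, since
    \<open>n choose (n + 1)\<close> is 0.\<close>
  also have "\<dots> = (\<Sum>k=0..n. 4 ^ k * real (n choose k) * real (n choose (k + 1)))"
    using assms by (intro sum.mono_neutral_left) auto
  finally have "real n * w $ n = \<dots>" .
  moreover have "arch_gf $ n = 2 * w $ n"
    using assms by (simp add: w_def)
  ultimately show ?thesis using assms by (simp add: field_simps)
qed

lemma arch_gf_compose_linear:
  "4 * fps_X ^ 4 * (arch_gf oo fps_X ^ 4) =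
     1 - fps_X ^ 4 - fps_sqrt (1 - 10 * fps_X ^ 4 + 9 * fps_X ^ 8)"
proof -
  have "fps_sqrt (1 - 10 * fps_X ^ 4 + 9 * fps_X ^ 8) = disc_root oo fps_X ^ 4"
  proof (rule fps_sqrt_unique)
    have "(disc_root oo fps_X ^ 4) ^ 2 = (1 - 10 * fps_X + 9 * fps_X ^ 2) oo fps_X ^ 4"
      by (simp add: fps_compose_power disc_root)
    then show "(disc_root oo fps_X ^ 4) ^ 2 = 1 - 10 * fps_X ^ 4 + 9 * fps_X ^ 8"
      by (simp add: fps_compose_add_distrib fps_compose_sub_distrib fps_compose_mult_distrib
          flip: fps_compose_power)
  qed (simp_all add: disc_root)
  then show ?thesis
    using arg_cong[OF arch_gf_linear, of "\<lambda>f. f oo fps_X ^ 4"]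
    by (simp add: fps_compose_add_distrib fps_compose_sub_distrib fps_compose_mult_distrib)
qed

lemma arch_gf_compose_quadratic:
  "(1 - fps_X ^ 4) * (arch_gf oo fps_X ^ 4) =
     1 - fps_X ^ 4 + 2 * fps_X ^ 4 * (arch_gf oo fps_X ^ 4) ^ 2"
  using arg_cong[OF arch_gf_quadratic, of "\<lambda>f. f oo fps_X ^ 4"]
  by (simp add: fps_compose_add_distrib fps_compose_sub_distrib fps_compose_mult_distrib
      flip: fps_compose_power)

section \<open>Asymptotics\<close>

text \<open>These are the Taylor coefficients of \<open>sqrt (1 - x)\<close>.\<close>

definition sqrt_coeff :: "nat \<Rightarrow> real" where
  "sqrt_coeff n = (-1) ^ n * ((1 / 2) gchoose n)"

lemma sqrt_coeff_0: "sqrt_coeff 0 = 1"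
  by (simp add: sqrt_coeff_def)

lemma sqrt_coeff_Suc: "sqrt_coeff (Suc n) = (real n - 1 / 2) / real (Suc n) * sqrt_coeff n"
proof -
  have "real (Suc n) * ((1 / 2) gchoose Suc n) = (1 / 2 - real n) * ((1 / 2 :: real) gchoose n)"
    by (metis gbinomial_absorb_comp gbinomial_absorption)
  then have g: "((1 / 2) gchoose Suc n) = (1 / 2 - real n) * ((1 / 2 :: real) gchoose n) / real (Suc n)"
    by (simp add: field_simps del: of_nat_Suc)
  show ?thesis
    unfolding sqrt_coeff_def g by (simp add: field_simps del: of_nat_Suc)
qed

lemma sqrt_coeff_nonzero: "sqrt_coeff n \<noteq> 0"
proof (induction n)
  case (Suc n)
  have "real n \<noteq> 1 / 2"
    by (metis dvd_triv_left even_numeral of_nat_eq_iff of_nat_mult of_nat_numeral of_nat_1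
        nonzero_eq_divide_eq odd_one mult.commute zero_neq_numeral)
  then show ?case using Suc by (simp add: sqrt_coeff_Suc del: of_nat_Suc)
qed (simp add: sqrt_coeff_0)

lemma abs_sqrt_coeff_le_1: "\<bar>sqrt_coeff n\<bar> \<le> 1"
proof (induction n)
  case (Suc n)
  have "\<bar>(real n - 1 / 2) / real (Suc n)\<bar> \<le> 1"
    by (simp add: abs_divide divide_le_eq abs_le_iff)
  then show ?case
    unfolding sqrt_coeff_Suc abs_mult using Suc by (intro mult_le_one) auto
qed (simp add: sqrt_coeff_0)

text \<open>The quotient of consecutive coefficients has absolute value at least 1/4, attained at
  \<open>n = 1\<close>. That 4 is below 9 later gives a convergent dominating series.\<close>

lemma abs_sqrt_coeff_le_Suc: "\<bar>sqrt_coeff n\<bar> \<le> 4 * \<bar>sqrt_coeff (Suc n)\<bar>"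
proof -
  have "1 \<le> 4 * \<bar>(real n - 1 / 2) / real (Suc n)\<bar>"
    by (cases n) (simp_all add: field_simps)
  from mult_right_mono[OF this, of "\<bar>sqrt_coeff n\<bar>"] show ?thesis
    unfolding sqrt_coeff_Suc abs_mult by simp
qed

lemma abs_sqrt_coeff_le_add: "\<bar>sqrt_coeff n\<bar> \<le> 4 ^ k * \<bar>sqrt_coeff (n + k)\<bar>"
proof (induction k)
  case (Suc k)
  have "4 ^ k * \<bar>sqrt_coeff (n + k)\<bar> \<le> 4 ^ k * (4 * \<bar>sqrt_coeff (n + Suc k)\<bar>)"
    using abs_sqrt_coeff_le_Suc[of "n + k"] by (intro mult_left_mono) auto
  from order_trans[OF Suc this] show ?case by (simp add: mult_ac)
qed simp

lemma sqrt_coeff_ratio: "(\<lambda>n. sqrt_coeff n / sqrt_coeff (n + k)) \<longlonglongrightarrow> 1"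
proof (induction k)
  case 0
  then show ?case by (simp add: sqrt_coeff_nonzero)
next
  case (Suc k)
  have "(\<lambda>m. real (Suc m) / (real m - 1 / 2)) \<longlonglongrightarrow> 1" by real_asymp
  then have "(\<lambda>m. sqrt_coeff m / sqrt_coeff (Suc m)) \<longlonglongrightarrow> 1"
    by (simp add: sqrt_coeff_Suc sqrt_coeff_nonzero del: of_nat_Suc)
  from tendsto_mult[OF Suc LIMSEQ_ignore_initial_segment[OF this, of k]] show ?case
    by (simp add: sqrt_coeff_nonzero)
qed

text \<open>The general asymptotics of \<open>gchoose\<close> has the constant
  \<open>1 / Gamma (- 1 / 2)\<close>; the functional equation reduces it to
  \<open>Gamma (1 / 2) = sqrt pi\<close>.\<close>

lemma sqrt_coeff_asymptotic: "(\<lambda>n. sqrt_coeff n * real n powr (3 / 2)) \<longlonglongrightarrow> - 1 / (2 * sqrt pi)"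
proof -
  have "(- 1 / 2 :: real) \<notin> \<int>"
  proof
    assume "(- 1 / 2 :: real) \<in> \<int>"
    then obtain m where "- 1 / 2 = real_of_int m" by (elim Ints_cases)
    then have "- 1 = 2 * m" by linarith
    then show False by presburger
  qed
  then have "Gamma (1 / 2) = - 1 / 2 * Gamma (- 1 / 2 :: real)"
    using Gamma_plus1[of "- 1 / 2 :: real"] nonpos_Ints_Int by fastforce
  then have "inverse (Gamma (- (1 / 2) :: real)) = - 1 / (2 * sqrt pi)"
    by (simp add: Gamma_one_half_real field_simps)
  with gbinomial_asymptotic[of "1 / 2 :: real"]
  have "(\<lambda>n. ((1 / 2) gchoose n) / ((-1) ^ n / exp ((1 / 2 + 1) * ln (real n)))) \<longlonglongrightarrow> - 1 / (2 * sqrt pi)"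
    by simp
  then show ?thesis
  proof (rule Lim_transform_eventually)
    show "\<forall>\<^sub>F n in sequentially.
        ((1 / 2) gchoose n) / ((-1) ^ n / exp ((1 / 2 + 1) * ln (real n))) = sqrt_coeff n * real n powr (3 / 2)"
      \<comment> \<open>At \<open>n = 0\<close> the two sides differ: \<open>powr\<close> with base
        0 is 0, while \<open>exp\<close> is positive.\<close>
      using eventually_gt_at_top[of "0::nat"]
    proof eventually_elim
      case (elim n)
      have "((1 / 2) gchoose n) / ((-1) ^ n / exp ((1 / 2 + 1) * ln (real n))) =
          sqrt_coeff n * exp ((1 / 2 + 1) * ln (real n))"
        unfolding sqrt_coeff_def by (cases "even n") simp_all
      moreover have "exp ((1 / 2 + 1) * ln (real n)) = real n powr (3 / 2)"
        using elim by (simp add: powr_def)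
      ultimately show ?case by (simp only:)
    qed
  qed
qed

lemma sqrt_coeff_sums:
  assumes "\<bar>x\<bar> < 1"
  shows "(\<lambda>n. sqrt_coeff n * x ^ n) sums sqrt (1 - x)"
proof -
  have "(\<lambda>n. (1 / 2 gchoose n) * (- x) ^ n) sums sqrt (1 - x)"
    using gen_binomial_real[of "- x" "1 / 2"] assms by (simp add: powr_half_sqrt)
  moreover have "(1 / 2 gchoose n) * (- x) ^ n = sqrt_coeff n * x ^ n" for n
    unfolding sqrt_coeff_def by (subst power_minus) (simp only: mult_ac)
  ultimately show ?thesis by (simp only:)
qed

section \<open>The coefficients of the discriminant root\<close>

lemma disc_root_nth:
  "disc_root $ n = (\<Sum>k=0..n. sqrt_coeff k * (9 ^ (n - k) * sqrt_coeff (n - k)))"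
proof -
  \<comment> \<open>\<open>B c\<close> is the square root of \<open>1 - fps_const c * fps_X\<close>,
    so \<open>B 1 * B 9\<close> is the required root.\<close>
  define B where "B = (\<lambda>c. fps_binomial (1 / 2 :: real) oo (fps_const (- c) * fps_X))"
  have B: "B c ^ 2 = 1 - fps_const c * fps_X" for c
  proof -
    have "B c ^ 2 = fps_binomial (1 / 2) ^ 2 oo (fps_const (- c) * fps_X)"
      unfolding B_def by (rule fps_compose_power) simp
    also have "fps_binomial (1 / 2 :: real) ^ 2 = 1 + fps_X"
      by (simp add: fps_binomial_power fps_binomial_1)
    finally show ?thesis
      by (simp add: fps_compose_add_distrib flip: fps_const_neg)
  qed
  have B_nth: "B c $ n = c ^ n * sqrt_coeff n" for c n
    unfolding B_def fps_compose_linear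
    by (simp add: sqrt_coeff_def power_minus[of c] mult_ac)
  have "disc_root = B 1 * B 9"
    unfolding disc_root_def
  proof (rule fps_sqrt_unique)
    show "(B 1 * B 9)\<^sup>2 = 1 - 10 * fps_X + 9 * fps_X\<^sup>2"
      unfolding power_mult_distrib B
      by (simp add: algebra_simps power2_eq_square flip: numeral_fps_const)
  qed (simp_all add: B_nth sqrt_coeff_0)
  then have "disc_root $ n = (B 1 * B 9) $ n" by (simp only:)
  then show ?thesis
    unfolding fps_mult_nth B_nth by simp
qed

lemma disc_root_limit:
  "(\<lambda>n. disc_root $ n / (9 ^ n * sqrt_coeff n)) \<longlonglongrightarrow> sqrt (8 / 9)"
proof -
  \<comment> \<open>The \<open>k\<close>-th term of the convolution after division by
    \<open>9 ^ n * sqrt_coeff n\<close>, extended by 0 so that the finite sums become series over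
    all \<open>k\<close>.\<close>
  define a where "a = (\<lambda>k n. if k \<le> n then
    sqrt_coeff k * (1 / 9) ^ k * (sqrt_coeff (n - k) / sqrt_coeff n) else 0)"
  have lim: "(\<lambda>n. a k n) \<longlonglongrightarrow> sqrt_coeff k * (1 / 9) ^ k" for k
  proof -
    have "(\<lambda>n. a k (n + k)) \<longlonglongrightarrow> sqrt_coeff k * (1 / 9) ^ k * 1"
      unfolding a_def using tendsto_mult[OF tendsto_const sqrt_coeff_ratio] by simp
    then show ?thesis by (simp add: LIMSEQ_offset[of _ k])
  qed
  \<comment> \<open>The factor \<open>4 ^ k\<close> bounds the quotient of coefficients
    \<open>k\<close> places apart, and \<open>(1 / 9) ^ k\<close> outweighs it.\<close>
  have bound: "norm (a k n) \<le> (4 / 9) ^ k" for k n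
  proof (cases "k \<le> n")
    case True
    have "\<bar>sqrt_coeff (n - k) / sqrt_coeff n\<bar> \<le> 4 ^ k"
      using abs_sqrt_coeff_le_add[of "n - k" k] True
      by (simp add: abs_divide divide_le_eq sqrt_coeff_nonzero)
    then have "\<bar>sqrt_coeff k\<bar> * (1 / 9) ^ k * \<bar>sqrt_coeff (n - k) / sqrt_coeff n\<bar> \<le> 1 * (1 / 9) ^ k * 4 ^ k"
      using abs_sqrt_coeff_le_1[of k] by (intro mult_mono) auto
    then show ?thesis
      using True by (simp add: a_def abs_mult power_divide)
  qed (simp add: a_def)
  have "(\<lambda>n. suminf (\<lambda>k. a k n)) \<longlonglongrightarrow> (\<Sum>k. sqrt_coeff k * (1 / 9) ^ k)"
  proof -
    have "\<forall>\<^sub>F (k, n) in at_top \<times>\<^sub>F sequentially. norm (a k n) \<le> (4 / 9) ^ k"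
      using bound by (intro always_eventually) auto
    from tannerys_theorem[OF lim this] show ?thesis by simp
  qed
  moreover have "(\<Sum>k. sqrt_coeff k * (1 / 9) ^ k) = sqrt (8 / 9)"
    using sqrt_coeff_sums[of "1 / 9", THEN sums_unique] by simp
  moreover have "suminf (\<lambda>k. a k n) = disc_root $ n / (9 ^ n * sqrt_coeff n)" for n
  proof -
    have "suminf (\<lambda>k. a k n) = (\<Sum>k=0..n. a k n)"
      by (rule suminf_finite) (auto simp: a_def)
    also have "\<dots> = (\<Sum>k=0..n. sqrt_coeff k * (9 ^ (n - k) * sqrt_coeff (n - k)) / (9 ^ n * sqrt_coeff n))"
    proof (rule sum.cong[OF refl])
      fix k assume k: "k \<in> {0..n}"
      then have "(9 :: real) ^ n = 9 ^ k * 9 ^ (n - k)" by (simp flip: power_add)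
      then show "a k n = sqrt_coeff k * (9 ^ (n - k) * sqrt_coeff (n - k)) / (9 ^ n * sqrt_coeff n)"
        using k by (simp add: a_def power_divide)
    qed
    finally show ?thesis
      by (simp add: disc_root_nth sum_divide_distrib)
  qed
  ultimately show ?thesis by simp
qed

lemma arch_gf_asymptotic:
  "(\<lambda>n. arch_gf $ n) \<sim>[at_top] (\<lambda>n. 3 ^ (1 + 2 * n) / (sqrt pi * (1 + 2 * real n) powr (3 / 2)))"
proof (rule asymp_equivI')
  let ?A = "\<lambda>n. disc_root $ Suc n / (9 ^ Suc n * sqrt_coeff (Suc n))"
  let ?B = "\<lambda>n. sqrt_coeff (Suc n) * real (Suc n) powr (3 / 2)"
  let ?C = "\<lambda>n. (1 + 2 * real n) powr (3 / 2) / real (Suc n) powr (3 / 2)"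
  \<comment> \<open>The quotient to be estimated, split into factors with known limits. The constant
    3/4 is \<open>9 / (4 * 3)\<close>: 9 from the index shift, 4 from \<open>arch_gf_linear\<close>,
    3 from the claimed asymptotics.\<close>
  have "(\<lambda>n. - (3 / 4 * sqrt pi) * (?A n * ?B n * ?C n)) \<longlonglongrightarrow>
      - (3 / 4 * sqrt pi) * (sqrt (8 / 9) * (- 1 / (2 * sqrt pi)) * 2 powr (3 / 2))"
  proof (intro tendsto_mult tendsto_const)
    show "?A \<longlonglongrightarrow> sqrt (8 / 9)"
      by (rule LIMSEQ_Suc[OF disc_root_limit])
    show "?B \<longlonglongrightarrow> - 1 / (2 * sqrt pi)"
      by (rule LIMSEQ_Suc[OF sqrt_coeff_asymptotic])
    show "?C \<longlonglongrightarrow> 2 powr (3 / 2)" by real_asymp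
  qed
  also have "- (3 / 4 * sqrt pi) * (sqrt (8 / 9) * (- 1 / (2 * sqrt pi)) * 2 powr (3 / 2)) = 1"
  proof -
    have "2 powr (3 / 2) = (2 :: real) powr (1 + 1 / 2)" by simp
    also have "\<dots> = 2 * sqrt 2" unfolding powr_add by (simp add: powr_half_sqrt)
    finally have "2 powr (3 / 2) = 2 * sqrt (2 :: real)" .
    moreover have "sqrt (8 / 9) = 2 / 3 * sqrt (2 :: real)"
      using real_sqrt_mult[of 4 2] by (simp add: real_sqrt_divide)
    ultimately show ?thesis by (simp add: field_simps)
  qed
  finally have "(\<lambda>n. - (3 / 4 * sqrt pi) * (?A n * ?B n * ?C n)) \<longlonglongrightarrow> 1" .
  then show "(\<lambda>n. arch_gf $ n / (3 ^ (1 + 2 * n) / (sqrt pi * (1 + 2 * real n) powr (3 / 2)))) \<longlonglongrightarrow> 1"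
  proof (rule Lim_transform_eventually)
    show "\<forall>\<^sub>F n in sequentially. - (3 / 4 * sqrt pi) * (?A n * ?B n * ?C n) =
        arch_gf $ n / (3 ^ (1 + 2 * n) / (sqrt pi * (1 + 2 * real n) powr (3 / 2)))"
      using eventually_gt_at_top[of "0::nat"]
    proof eventually_elim
      case (elim n)
      have "(4 * fps_X * arch_gf) $ Suc n = (1 - fps_X - disc_root) $ Suc n"
        by (simp only: arch_gf_linear)
      \<comment> \<open>For \<open>n > 0\<close> the polynomial \<open>1 - fps_X\<close> has no
        coefficient at \<open>Suc n\<close>.\<close>
      then have "4 * arch_gf $ n = - (disc_root $ Suc n)"
        using elim by (simp add: mult.assoc)
      then have R: "disc_root $ Suc n = - 4 * arch_gf $ n" by simp
      have "(3 :: real) ^ (1 + 2 * n) = 3 * 9 ^ n" by (simp add: power_mult)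
      moreover have "real (Suc n) powr (3 / 2) \<noteq> 0" by simp
      ultimately show ?case
        unfolding R using sqrt_coeff_nonzero[of "Suc n"]
        by (simp add: field_simps del: of_nat_Suc)
    qed
  qed
qed

section \<open>Packing paths\<close>

theorem corollary3:
  fixes r :: "real fps"
  assumes "r = (1 - 3 * fps_X ^ 4 - fps_sqrt (9 * fps_X ^ 8 - 10 * fps_X ^ 4 + 1)) / (2 * fps_X ^ 2)"
  shows "packing_gf = (fps_X ^ 2 + r) / (2 * fps_X ^ 2) \<and>
         (fps_X ^ 2 + r) / (2 * fps_X ^ 2) =
           (1 - fps_X ^ 4 - fps_sqrt (1 - 10 * fps_X ^ 4 + 9 * fps_X ^ 8)) / (4 * fps_X ^ 4) \<and>
         fps_nth packing_gf 0 = 1 \<and>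
         (\<forall>n::nat. n \<ge> 1 \<longrightarrow> fps_nth packing_gf (4 * n) =
           2 / real n * (\<Sum>k=0..n. 4 ^ k * real (n choose k) * real (n choose (k + 1)))) \<and>
         (\<forall>m::nat. \<not> 4 dvd m \<longrightarrow> fps_nth packing_gf m = 0) \<and>
         (\<lambda>n::nat. fps_nth packing_gf (4 * n)) \<sim>[at_top]
           (\<lambda>n. 3 ^ (1 + 2 * n) / (sqrt pi * (1 + 2 * real n) powr (3 / 2)))"
proof -
  define S where "S = arch_gf oo fps_X ^ 4"
  let ?Q = "fps_sqrt (1 - 10 * fps_X ^ 4 + 9 * fps_X ^ 8)"
  have linear: "4 * fps_X ^ 4 * S = 1 - fps_X ^ 4 - ?Q"
    unfolding S_def by (rule arch_gf_compose_linear)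
  have gf: "packing_gf = S"
    using arch_gf_compose_quadratic unfolding S_def by (rule packing_gf_unique)
  have poly: "9 * fps_X ^ 8 - 10 * fps_X ^ 4 + 1 = (1 - 10 * fps_X ^ 4 + 9 * fps_X ^ 8 :: real fps)"
    by simp
  have "1 - 3 * fps_X ^ 4 - ?Q = 4 * fps_X ^ 4 * S - 2 * fps_X ^ 4"
    unfolding linear by simp
  \<comment> \<open>The numerator is a multiple of the denominator, so the division defining
    \<open>r\<close> is exact.\<close>
  also have "\<dots> = 2 * fps_X ^ 2 * (fps_X ^ 2 * (2 * S - 1))"
    by (simp add: algebra_simps eval_nat_numeral)
  finally have "r = fps_X ^ 2 * (2 * S - 1)"
    unfolding assms poly by (simp only:) (rule nonzero_mult_div_cancel_left, simp)
  then have "fps_X ^ 2 + r = 2 * fps_X ^ 2 * S"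
    by (simp add: algebra_simps)
  then have r: "(fps_X ^ 2 + r) / (2 * fps_X ^ 2) = S"
    by (simp only:) (rule nonzero_mult_div_cancel_left, simp)
  have quot: "(1 - fps_X ^ 4 - ?Q) / (4 * fps_X ^ 4) = S"
    unfolding linear[symmetric] by (rule nonzero_mult_div_cancel_left) simp
  have S_nth: "S $ m = (if 4 dvd m then arch_gf $ (m div 4) else 0)" for m
    unfolding S_def by (rule fps_nth_compose_X_power) simp
  show ?thesis
    unfolding gf r quot using arch_gf_nth arch_gf_asymptotic
    by (simp add: S_nth arch_gf_nth_0)
qed

end
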